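(* Let $\mathcal{L}:\mathbb{F}^{q\times q}\to\mathbb{F}^{n\times n}$ be a positive $*$-linear map ($\mathbb{F}=\mathbb{C}$ or $\mathbb{R}$), let $m$ be the rank of its Choi matrix $\mathbb{L}$, and let $\widehat{A}\in\mathbb{F}^{m\times nq}$ be the matrix associated with a minimal Hill representation of $\mathcal{L}$. If $$\mathfrak{Y}_{\widehat{A}}:=\{\widehat{A}(z\otimes x):x\in\mathbb{F}^n,\ z\in\mathbb{F}^q\}=\mathbb{F}^m,$$ then $\mathcal{L}$ is completely positive.
   Context: Notation: $^*$ denotes the adjoint (the transpose when $\mathbb{F}=\mathbb{R}$); $\otimes$ is the Kronecker product; $\operatorname{vec}$ stacks the columns of a matrix. A linear map $\mathcal{L}:\mathbb{F}^{q\times q}\to\mathbb{F}^{n\times n}$ is $*$-linear if $\mathcal{L}(V^* )=\mathcal{L}(V)^*$ for all $V$; positive if it maps positive semidefinite (Hermitian) matrices to positive semidefinite matrices; completely positive if for every $k\ge1$ the map $[V_{ab}]_{a,b=1}^k\mapsto[\mathcal{L}(V_{ab})]_{a,b=1}^k$ is positive (equivalently, the Choi matrix is positive semidefinite). The Choi matrix is $\mathbb{L}=[\mathcal{L}(\mathcal{E}_{ij}^{(q)})]_{i,j=1}^q\in\mathbb{F}^{nq\times nq}$, with $\mathcal{E}_{ij}^{(q)}$ the matrix units. A Hill representation of $\mathcal{L}$ is a representation $\mathcal{L}(V)=\sum_{k,l=1}^{m}\mathbb{H}_{kl}A_kVA_l^*$ for all $V\in\mathbb{F}^{q\times q}$,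 with $A_1,\ldots,A_m\in\mathbb{F}^{n\times q}$ and $\mathbb{H}=[\mathbb{H}_{kl}]\in\mathbb{F}^{m\times m}$; it is minimal if no Hill representation of $\mathcal{L}$ uses fewer matrices $A_k$. It is known that the minimal number is $m=\operatorname{rank}\mathbb{L}$ and that every $*$-linear map has a minimal Hill representation. The matrix $\widehat{A}\in\mathbb{F}^{m\times nq}$ associated with a minimal Hill representation is defined by $\widehat{A}^*=[\operatorname{vec}(A_1)\ \cdots\ \operatorname{vec}(A_m)]$. *)

theory Defs
  imports
    "Jordan_Normal_Form.Schur_Decomposition"
    "Jordan_Normal_Form.DL_Rank"
    "Jordan_Normal_Form.VS_Connect"
begin

text \<open>
  Matrices have explicit dimensions, so that complete positivity can quantify over the block
  size. All indices start at 0. The definitions are generic in the scalars and are meant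
  for complex numbers, where \<^const>\<open>conjugate\<close> is complex conjugation, and for real numbers,
  where it is the identity.
\<close>

text \<open>
  For complex scalars \<open>0 \<le> a\<close> says that \<open>a\<close> is real and nonnegative; the last conjunct is
  \<open>x\<^sup>* M x \<ge> 0\<close>. The real case includes symmetry of \<open>M\<close>.
\<close>
definition psd :: "nat \<Rightarrow> 'a :: conjugatable_ordered_field mat \<Rightarrow> bool" where
  "psd d M \<longleftrightarrow> M \<in> carrier_mat d d \<and> mat_adjoint M = M \<and>
     (\<forall>x \<in> carrier_vec d. 0 \<le> (M *\<^sub>v x) \<bullet>c x)"

definition lin_map :: "nat \<Rightarrow> nat \<Rightarrow> ('a :: field mat \<Rightarrow> 'a mat) \<Rightarrow> bool" where
  "lin_map q n L \<longleftrightarrow>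
     linear_map class_ring (module_mat TYPE('a) q q) (module_mat TYPE('a) n n) L"

definition star_linear :: "nat \<Rightarrow> nat \<Rightarrow> ('a :: conjugatable_field mat \<Rightarrow> 'a mat) \<Rightarrow> bool" where
  "star_linear q n L \<longleftrightarrow> lin_map q n L \<and>
     (\<forall>V \<in> carrier_mat q q. L (mat_adjoint V) = mat_adjoint (L V))"

definition positive_map ::
    "nat \<Rightarrow> nat \<Rightarrow> ('a :: conjugatable_ordered_field mat \<Rightarrow> 'a mat) \<Rightarrow> bool" where
  "positive_map q n L \<longleftrightarrow> (\<forall>V. psd q V \<longrightarrow> psd n (L V))"

text \<open>The \<open>k \<times> k\<close> block matrix whose \<open>(a, b)\<close> block is the \<open>d \<times> d\<close> matrix \<open>B a b\<close>.\<close>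
definition block_mat :: "nat \<Rightarrow> nat \<Rightarrow> (nat \<Rightarrow> nat \<Rightarrow> 'a mat) \<Rightarrow> 'a mat" where
  "block_mat k d B =
     mat (k * d) (k * d) (\<lambda>(i, j). B (i div d) (j div d) $$ (i mod d, j mod d))"

definition completely_positive ::
    "nat \<Rightarrow> nat \<Rightarrow> ('a :: conjugatable_ordered_field mat \<Rightarrow> 'a mat) \<Rightarrow> bool" where
  "completely_positive q n L \<longleftrightarrow>
     (\<forall>k \<ge> 1. \<forall>V. (\<forall>a < k. \<forall>b < k. V a b \<in> carrier_mat q q) \<longrightarrow>
        psd (k * q) (block_mat k q V) \<longrightarrow> psd (k * n) (block_mat k n (\<lambda>a b. L (V a b))))"

definition matrix_unit :: "nat \<Rightarrow> nat \<Rightarrow> nat \<Rightarrow> 'a :: zero_neq_one mat" where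
  "matrix_unit q i j = mat q q (\<lambda>(a, b). if a = i \<and> b = j then 1 else 0)"

definition choi_matrix :: "nat \<Rightarrow> nat \<Rightarrow> ('a :: field mat \<Rightarrow> 'a mat) \<Rightarrow> 'a mat" where
  "choi_matrix q n L = block_mat q n (\<lambda>i j. L (matrix_unit q i j))"

text \<open>
  A family of \<open>m\<close> matrices is given by the values of \<open>A\<close> below \<open>m\<close>. The sum of matrices is
  written entrywise, since matrices of unspecified size do not form a monoid.
\<close>
definition hill_rep :: "nat \<Rightarrow> nat \<Rightarrow> ('a :: conjugatable_field mat \<Rightarrow> 'a mat) \<Rightarrow>
    nat \<Rightarrow> 'a mat \<Rightarrow> (nat \<Rightarrow> 'a mat) \<Rightarrow> bool" where
  "hill_rep q n L m H A \<longleftrightarrow>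
     H \<in> carrier_mat m m \<and> (\<forall>k < m. A k \<in> carrier_mat n q) \<and>
     (\<forall>V \<in> carrier_mat q q. L V =
        mat n n (\<lambda>(i, j). \<Sum>k<m. \<Sum>l<m. H $$ (k, l) * (A k * V * mat_adjoint (A l)) $$ (i, j)))"

definition minimal_hill_rep :: "nat \<Rightarrow> nat \<Rightarrow> ('a :: conjugatable_field mat \<Rightarrow> 'a mat) \<Rightarrow>
    nat \<Rightarrow> 'a mat \<Rightarrow> (nat \<Rightarrow> 'a mat) \<Rightarrow> bool" where
  "minimal_hill_rep q n L m H A \<longleftrightarrow>
     hill_rep q n L m H A \<and> (\<forall>m' H' A'. hill_rep q n L m' H' A' \<longrightarrow> m \<le> m')"

text \<open>The columns stacked into one vector; entry \<open>(i, j)\<close> is moved to position \<open>j * dim_row M + i\<close>.\<close>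
definition vectorize :: "'a mat \<Rightarrow> 'a vec" where
  "vectorize M =
     vec (dim_row M * dim_col M) (\<lambda>p. M $$ (p mod dim_row M, p div dim_row M))"

definition kronecker_vec :: "'a :: times vec \<Rightarrow> 'a vec \<Rightarrow> 'a vec" where
  "kronecker_vec z x = vec (dim_vec z * dim_vec x) (\<lambda>p. z $ (p div dim_vec x) * x $ (p mod dim_vec x))"

definition A_hat :: "nat \<Rightarrow> nat \<Rightarrow> nat \<Rightarrow> (nat \<Rightarrow> 'a :: conjugatable_field mat) \<Rightarrow> 'a mat" where
  "A_hat q n m A = mat_adjoint (mat_of_cols (n * q) (map (\<lambda>k. vectorize (A k)) [0..<m]))"

definition Y_set :: "nat \<Rightarrow> nat \<Rightarrow> 'a :: semiring_0 mat \<Rightarrow> 'a vec set" where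
  "Y_set q n M = {M *\<^sub>v kronecker_vec z x | x z. x \<in> carrier_vec n \<and> z \<in> carrier_vec q}"

end

theory Submission imports Defs begin

text \<open>
  Let \<open>y = A_hat (z \<otimes> x)\<close>. Substituting the rank-one matrix whose \<open>(r, s)\<close> entry is
  \<open>conjugate z\<^sub>r * z\<^sub>s\<close> into the Hill representation gives
  \<open>x\<^sup>* L(V) x = (\<Sum>k l. H\<^sub>k\<^sub>l * conjugate y\<^sub>k * y\<^sub>l)\<close>. Positivity of \<open>L\<close> therefore gives
  \<open>y\<^sup>* H y \<ge> 0\<close> for every \<open>y\<close> in the set \<open>Y\<close> of vectors of this shape. If \<open>Y\<close> is the whole
  space, the quadratic form of \<open>H\<close> is nonnegative everywhere (\<open>hill_matrix_nonneg\<close>).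

  A Hill representation with such an \<open>H\<close> makes \<open>L\<close> completely positive. Test the block matrix
  \<open>[L(V\<^sub>a\<^sub>b)]\<close> on a block vector with blocks \<open>c\<^sub>a\<close>, and let \<open>w\<^sub>k\<close> be the block vector with blocks
  \<open>A\<^sub>k\<^sup>* c\<^sub>a\<close>. The result is \<open>(\<Sum>k l. H\<^sub>k\<^sub>l * G\<^sub>k\<^sub>l)\<close>, where \<open>G\<^sub>k\<^sub>l = w\<^sub>k\<^sup>* [V\<^sub>a\<^sub>b] w\<^sub>l\<close> is the Gram matrix
  of the \<open>w\<^sub>k\<close> with respect to a positive semidefinite matrix, hence is itself positive
  semidefinite (\<open>gram_kernel\<close>). Writing \<open>G\<close> as a sum of positive semidefinite rank-one matrices
  shows that the pairing with \<open>H\<close> is nonnegative (\<open>nonneg_kernel_pairing\<close>).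

  In the real case a nonnegative quadratic form does not force \<open>H\<close> to be symmetric. This is
  harmless: the pairing with the symmetric matrix \<open>G\<close> sees only the symmetric part of \<open>H\<close>. So both
  scalar fields are treated at once, with the rank-one decomposition of \<open>G\<close> obtained by
  elimination (Schur complements), which takes no square roots and no eigenvalues.
\<close>

section \<open>Nonnegative kernels and their pairing\<close>

text \<open>
  Matrices are handled as functions on an arbitrary index set here, so that elimination can
  remove one index from the set without renumbering the others.
\<close>
definition quad_form :: "'i set \<Rightarrow> ('i \<Rightarrow> 'i \<Rightarrow> 'a :: conjugatable_field) \<Rightarrow> ('i \<Rightarrow> 'a) \<Rightarrow> 'a" where
  "quad_form S K c = (\<Sum>k\<in>S. \<Sum>l\<in>S. conjugate (c k) * K k l * c l)"

definition nonneg_kernel ::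
    "'i set \<Rightarrow> ('i \<Rightarrow> 'i \<Rightarrow> 'a :: conjugatable_ordered_field) \<Rightarrow> bool" where
  "nonneg_kernel S K \<longleftrightarrow> (\<forall>c. 0 \<le> quad_form S K c)"

definition hermitian_kernel :: "'i set \<Rightarrow> ('i \<Rightarrow> 'i \<Rightarrow> 'a :: conjugate) \<Rightarrow> bool" where
  "hermitian_kernel S K \<longleftrightarrow> (\<forall>k\<in>S. \<forall>l\<in>S. conjugate (K k l) = K l k)"

lemma conjugate_one [simp]: "conjugate 1 = (1 :: 'a :: conjugatable_field)"
proof -
  have "conjugate 1 * conjugate 1 = conjugate (1 :: 'a)"
    by (simp flip: conjugate_dist_mul)
  then show ?thesis
    by simp
qed

lemma conjugate_inverse: "conjugate (inverse a) = inverse (conjugate (a :: 'a :: conjugatable_field))"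
proof (cases "a = 0")
  case False
  then have "conjugate a * conjugate (inverse a) = 1"
    by (simp flip: conjugate_dist_mul)
  then show ?thesis
    using inverse_unique by metis
qed simp

text \<open>
  The order is only partial, so the contradiction cannot come from comparability; it comes from
  \<open>0 \<le> 1\<close>, which holds because \<open>1\<close> is the square \<open>1 * conjugate 1\<close>.
\<close>
lemma not_zero_le_minus_two:
  "\<not> 0 \<le> - (1 + 1 :: 'a :: {conjugatable_ordered_field, ordered_comm_ring})"
proof
  assume *: "0 \<le> - (1 + 1 :: 'a)"
  have 1: "0 \<le> (1 :: 'a)"
    using conjugate_square_positive[of "1 :: 'a"] by simp
  have "1 + 1 \<le> (0 :: 'a)"
    using * by (metis neg_0_le_iff_le)
  moreover have "(1 :: 'a) \<le> 1 + 1"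
    using add_left_mono[OF 1, of 1] by simp
  ultimately have "(1 :: 'a) \<le> 0"
    by (rule order_trans[rotated])
  with 1 show False
    by (metis antisym zero_neq_one)
qed

lemma quad_form_restrict:
  assumes "finite S" "T \<subseteq> S"
  shows "quad_form S K (\<lambda>k. if k \<in> T then c k else 0) = quad_form T K c"
  unfolding quad_form_def
  by (intro sum.mono_neutral_cong_right) (use assms in auto)

lemma nonneg_kernel_subset:
  assumes "finite S" "nonneg_kernel S K" "T \<subseteq> S"
  shows "nonneg_kernel T K"
  using assms unfolding nonneg_kernel_def by (metis quad_form_restrict)

lemma quad_form_rank_one:
  fixes y :: "'i \<Rightarrow> 'a :: conjugatable_field"
  shows "quad_form S (\<lambda>k l. t * (conjugate (y k) * y l)) c =
    t * ((\<Sum>k\<in>S. y k * c k) * conjugate (\<Sum>k\<in>S. y k * c k))"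
proof (cases "finite S")
  case True
  have "(\<Sum>k\<in>S. y k * c k) * conjugate (\<Sum>k\<in>S. y k * c k) =
    (\<Sum>k\<in>S. \<Sum>l\<in>S. conjugate (y k * c k) * (y l * c l))"
    by (subst mult.commute) (simp add: sum_conjugate[OF True] sum_product)
  then show ?thesis
    unfolding quad_form_def
    by (simp add: sum_distrib_left conjugate_dist_mul mult_ac)
qed (simp add: quad_form_def)

lemma nonneg_diagonal:
  assumes "finite S" "nonneg_kernel S K" "k \<in> S"
  shows "0 \<le> K k k"
proof -
  have "0 \<le> quad_form {k} K (\<lambda>_. 1)"
    using nonneg_kernel_subset[OF assms(1,2), of "{k}"] assms(3)
    unfolding nonneg_kernel_def by blast
  then show ?thesis
    by (simp add: quad_form_def)
qed

text \<open>
  On the two indices \<open>k\<close> and \<open>p\<close> the form has no term of second order in the coefficient \<open>u\<close> of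
  \<open>p\<close>, because \<open>K p p = 0\<close>. If the mixed coefficient \<open>K k p\<close> did not vanish, a
  suitable \<open>u\<close> would make the form negative.
\<close>
lemma zero_diagonal_zero_column:
  fixes K :: "'i \<Rightarrow> 'i \<Rightarrow> 'a :: {conjugatable_ordered_field, ordered_comm_ring}"
  assumes fin: "finite S" and nn: "nonneg_kernel S K" and herm: "hermitian_kernel S K"
    and p: "p \<in> S" and k: "k \<in> S" and zero: "K p p = 0"
  shows "K k p = 0"
proof (rule ccontr)
  assume nz: "K k p \<noteq> 0"
  with zero have ne: "k \<noteq> p" by auto
  (* Any u with K k p * u real and below - K k k / 2 would do; this one avoids division by 2. *)
  define u where "u = - (K k k + 1) / K k p"
  have u: "K k p * u = - (K k k + 1)"
    using nz by (simp add: u_def)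
  have "conjugate u * K p k = conjugate (K k p * u)"
    using herm k p by (simp add: hermitian_kernel_def conjugate_dist_mul mult.commute)
  also have "\<dots> = - (K k k + 1)"
    using herm k by (simp add: u hermitian_kernel_def conjugate_neg conjugate_dist_add
      del: minus_add_distrib)
  finally have u': "conjugate u * K p k = - (K k k + 1)" .
  have "0 \<le> quad_form {k, p} K (\<lambda>i. if i = p then u else 1)"
    using nonneg_kernel_subset[OF fin nn, of "{k, p}"] k p
    unfolding nonneg_kernel_def by blast
  also have "\<dots> = K k k + K k p * u + conjugate u * K p k"
    using ne zero by (simp add: quad_form_def)
  also have "\<dots> = - (1 + 1) - K k k"
    by (simp add: u u')
  finally have "K k k \<le> - (1 + 1)"
    by (metis diff_ge_0_iff_ge)
  then show False
    using nonneg_diagonal[OF fin nn k] not_zero_le_minus_two order_trans by blast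
qed

text \<open>
  Induction on the index set by elimination of an index \<open>p\<close>: subtracting from \<open>G\<close> the rank-one
  kernel built from its row \<open>p\<close> leaves the Schur complement \<open>G'\<close>, which vanishes in row and
  column \<open>p\<close> and is again nonnegative. The rank-one kernel pairs with \<open>H\<close> to a nonnegative
  multiple of a value of the quadratic form of \<open>H\<close>.
\<close>
lemma nonneg_kernel_pairing:
  fixes G H :: "'i \<Rightarrow> 'i \<Rightarrow> 'a :: {conjugatable_ordered_field, ordered_comm_ring}"
  assumes "finite S" "nonneg_kernel S H" "nonneg_kernel S G" "hermitian_kernel S G"
  shows "0 \<le> (\<Sum>k\<in>S. \<Sum>l\<in>S. H k l * G k l)"
  using assms
proof (induction S arbitrary: G rule: finite_induct)
  case empty
  then show ?case by simp
next
  case (insert p S)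
  note H = insert.prems(1) and G = insert.prems(2) and herm = insert.prems(3)
  let ?S = "insert p S"
  have fin: "finite ?S" using insert.hyps by simp
  have conj: "conjugate (G k l) = G l k" if "k \<in> ?S" "l \<in> ?S" for k l
    using herm that unfolding hermitian_kernel_def by blast
  (* If G p p = 0, then t = 0 and nothing is subtracted; row p of G is then already zero, so
     both cases share the identity row below. *)
  define t where "t = inverse (G p p)"
  have t_conj: "conjugate t = t"
    using conj[of p p] by (simp add: t_def conjugate_inverse)
  (* A positive scalar need not have a positive inverse by any axiom of the scalars, but
     t = G p p * (t * conjugate t) is a product of two nonnegative factors. *)
  have t_nonneg: "0 \<le> t"
  proof -
    have "0 \<le> G p p * (t * conjugate t)"
      by (intro mult_nonneg_nonneg conjugate_square_positive nonneg_diagonal[OF fin G]) simp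
    also have "\<dots> = t"
      unfolding t_conj by (cases "G p p = 0") (simp_all add: t_def)
    finally show ?thesis .
  qed
  have row: "G p p * t * G p l = G p l" if l: "l \<in> ?S" for l
  proof (cases "G p p = 0")
    case True
    then have "G l p = 0"
      using zero_diagonal_zero_column[OF fin G herm _ l] by simp
    then have "G p l = 0"
      using conj[OF l, of p] by simp
    then show ?thesis by simp
  qed (simp add: t_def)
  define y where "y = G p"
  define G' where "G' k l = G k l - t * (conjugate (y k) * y l)" for k l
  have y_conj: "conjugate (y k) = G k p" if "k \<in> ?S" for k
    using conj[OF _ that, of p] by (simp add: y_def)
  have row': "G' p l = 0" if "l \<in> ?S" for l
    using row[OF that] by (simp add: G'_def y_conj) (simp add: y_def mult_ac)
  have herm': "hermitian_kernel ?S G'"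
    using conj unfolding hermitian_kernel_def G'_def
    by (simp add: conjugate_dist_mul conjugate_dist_add conjugate_neg t_conj mult_ac
        diff_conv_add_uminus del: add_uminus_conv_diff)
  have col': "G' k p = 0" if "k \<in> ?S" for k
  proof -
    have "conjugate (G' p k) = G' k p"
      using herm' that unfolding hermitian_kernel_def by blast
    then show ?thesis
      using row'[OF that] by simp
  qed
  have nn': "nonneg_kernel S G'"
    unfolding nonneg_kernel_def
  proof
    fix c
    (* The coefficient at p minimises the form of G; it makes c' orthogonal to row p, so that
       the rank-one term contributes nothing. *)
    define \<sigma> where "\<sigma> = (\<Sum>l\<in>S. y l * c l)"
    define c' where "c' = c(p := - (t * \<sigma>))"
    have "G p p * t * \<sigma> = \<sigma>"
      unfolding \<sigma>_def y_def sum_distrib_left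
      by (intro sum.cong refl) (simp only: mult.assoc[symmetric] row insertI2)
    moreover have "(\<Sum>l\<in>S. y l * c' l) = \<sigma>"
      unfolding \<sigma>_def using insert.hyps by (intro sum.cong) (auto simp: c'_def)
    ultimately have orth: "(\<Sum>l\<in>?S. y l * c' l) = 0"
      using insert.hyps by (simp add: c'_def y_def mult_ac)
    have "quad_form S G' c = quad_form ?S G' c'"
      unfolding quad_form_def using insert.hyps
      by (simp add: row' col') (intro sum.cong, auto simp: c'_def)
    also have "\<dots> = quad_form ?S G c' - quad_form ?S (\<lambda>k l. t * (conjugate (y k) * y l)) c'"
      unfolding quad_form_def G'_def
      by (simp only: sum_subtractf[symmetric] left_diff_distrib right_diff_distrib)
    also have "\<dots> = quad_form ?S G c'"
      unfolding quad_form_rank_one orth by simp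
    finally show "0 \<le> quad_form S G' c"
      using G by (simp add: nonneg_kernel_def)
  qed
  have "0 \<le> (\<Sum>k\<in>S. \<Sum>l\<in>S. H k l * G' k l) + t * quad_form ?S H y"
  proof (intro add_nonneg_nonneg mult_nonneg_nonneg t_nonneg)
    show "0 \<le> quad_form ?S H y"
      using H by (simp add: nonneg_kernel_def)
    show "0 \<le> (\<Sum>k\<in>S. \<Sum>l\<in>S. H k l * G' k l)"
      using herm' by (intro insert.IH nn' nonneg_kernel_subset[OF fin H])
        (auto simp: hermitian_kernel_def)
  qed
  also have "(\<Sum>k\<in>S. \<Sum>l\<in>S. H k l * G' k l) = (\<Sum>k\<in>?S. \<Sum>l\<in>?S. H k l * G' k l)"
    using insert.hyps by (simp add: row' col')
  also have "\<dots> + t * quad_form ?S H y = (\<Sum>k\<in>?S. \<Sum>l\<in>?S. H k l * G k l)"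
    unfolding quad_form_def G'_def sum_distrib_left sum.distrib[symmetric]
    by (intro sum.cong) (simp_all add: algebra_simps)
  finally show ?case .
qed

section \<open>Matrices as kernels\<close>

lemma sum_swap_one_pair:
  "(\<Sum>j\<in>J. \<Sum>r\<in>R. \<Sum>s\<in>S. f j r s) = (\<Sum>r\<in>R. \<Sum>s\<in>S. \<Sum>j\<in>J. f j r s)"
  by (subst sum.swap) (intro sum.cong refl sum.swap)

lemma sum_swap_pairs:
  "(\<Sum>i\<in>I. \<Sum>j\<in>J. \<Sum>r\<in>R. \<Sum>s\<in>S. f i j r s) = (\<Sum>r\<in>R. \<Sum>s\<in>S. \<Sum>i\<in>I. \<Sum>j\<in>J. f i j r s)"
proof -
  have "(\<Sum>i\<in>I. \<Sum>j\<in>J. \<Sum>r\<in>R. \<Sum>s\<in>S. f i j r s) = (\<Sum>i\<in>I. \<Sum>r\<in>R. \<Sum>s\<in>S. \<Sum>j\<in>J. f i j r s)"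
    by (intro sum.cong refl sum_swap_one_pair)
  also have "\<dots> = (\<Sum>r\<in>R. \<Sum>s\<in>S. \<Sum>i\<in>I. \<Sum>j\<in>J. f i j r s)"
    by (rule sum_swap_one_pair)
  finally show ?thesis .
qed

lemma sum_blocks:
  "(\<Sum>i<k * (d :: nat). f i) = (\<Sum>a<k. \<Sum>i<d. f (a * d + i))"
proof -
  have "sum f {a * d..<a * d + d} = (\<Sum>i<d. f (a * d + i))" for a
    using sum.shift_bounds_nat_ivl[of f 0 "a * d" d]
    by (simp add: atLeast0LessThan add.commute)
  then show ?thesis
    by (simp add: sum.nat_group[symmetric])
qed

lemma mat_adjoint_index:
  "mat_adjoint M = mat (dim_col M) (dim_row M) (\<lambda>(i, j). conjugate (M $$ (j, i)))"
  by (rule eq_matI) (auto simp: mat_adjoint_def mat_of_rows_def)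

lemma psd_iff_kernel:
  "psd d M \<longleftrightarrow> M \<in> carrier_mat d d \<and> hermitian_kernel {..<d} (\<lambda>i j. M $$ (i, j)) \<and>
     nonneg_kernel {..<d} (\<lambda>i j. M $$ (i, j))"
proof (cases "M \<in> carrier_mat d d")
  case M: True
  have adj: "mat_adjoint M = M \<longleftrightarrow> hermitian_kernel {..<d} (\<lambda>i j. M $$ (i, j))"
    using M by (auto simp: mat_adjoint_index mat_eq_iff hermitian_kernel_def)
  have form: "(M *\<^sub>v vec d c) \<bullet>c vec d c = quad_form {..<d} (\<lambda>i j. M $$ (i, j)) c" for c
    using M by (auto simp: quad_form_def scalar_prod_def atLeast0LessThan sum_distrib_left
        sum_distrib_right mult_ac intro!: sum.cong)
  have "(\<forall>x \<in> carrier_vec d. 0 \<le> (M *\<^sub>v x) \<bullet>c x) \<longleftrightarrow> (\<forall>c. 0 \<le> (M *\<^sub>v vec d c) \<bullet>c vec d c)"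
  proof safe
    fix x :: "'a vec" assume "\<forall>c. 0 \<le> (M *\<^sub>v vec d c) \<bullet>c vec d c" "x \<in> carrier_vec d"
    moreover from this have "vec d (($) x) = x" by auto
    ultimately show "0 \<le> (M *\<^sub>v x) \<bullet>c x" by metis
  qed simp
  then show ?thesis
    using M adj form by (simp add: psd_def nonneg_kernel_def)
qed (simp add: psd_def)

lemma index_mult_mult_adjoint:
  assumes "A \<in> carrier_mat n q" "V \<in> carrier_mat q q" "B \<in> carrier_mat n q" "i < n" "j < n"
  shows "(A * V * mat_adjoint B) $$ (i, j) =
    (\<Sum>r<q. \<Sum>s<q. A $$ (i, r) * V $$ (r, s) * conjugate (B $$ (j, s)))"
proof -
  have "(A * V * mat_adjoint B) $$ (i, j) =
    (\<Sum>s<q. \<Sum>r<q. A $$ (i, r) * V $$ (r, s) * conjugate (B $$ (j, s)))"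
    using assms by (simp add: mat_adjoint_index scalar_prod_def atLeast0LessThan sum_distrib_right)
  also have "\<dots> = (\<Sum>r<q. \<Sum>s<q. A $$ (i, r) * V $$ (r, s) * conjugate (B $$ (j, s)))"
    by (rule sum.swap)
  finally show ?thesis .
qed

section \<open>Hill representations\<close>

text \<open>
  The vector \<open>M\<^sup>* c\<close> for a matrix \<open>M\<close> with \<open>n\<close> rows. Vectors are functions, so that a block of a
  long vector is a shift of its argument.
\<close>
definition adjoint_apply :: "nat \<Rightarrow> 'a :: conjugatable_field mat \<Rightarrow> (nat \<Rightarrow> 'a) \<Rightarrow> nat \<Rightarrow> 'a" where
  "adjoint_apply n M c s = (\<Sum>j<n. conjugate (M $$ (j, s)) * c j)"

text \<open>
  The identity behind both halves of the argument: testing \<open>L(V)\<close> between two vectors tests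
  \<open>V\<close> between their images under the \<open>A\<^sub>k\<^sup>*\<close>. Two different vectors are needed for the
  off-diagonal blocks of a block matrix.
\<close>
lemma hill_rep_form:
  assumes hill: "hill_rep q n L m H A" and V: "V \<in> carrier_mat q q"
  shows "(\<Sum>i<n. \<Sum>j<n. conjugate (c i) * L V $$ (i, j) * c' j) =
    (\<Sum>k<m. \<Sum>l<m. H $$ (k, l) * (\<Sum>r<q. \<Sum>s<q.
       conjugate (adjoint_apply n (A k) c r) * V $$ (r, s) * adjoint_apply n (A l) c' s))"
proof -
  have one: "(\<Sum>i<n. \<Sum>j<n. conjugate (c i) *
      (\<Sum>r<q. \<Sum>s<q. M $$ (i, r) * V $$ (r, s) * conjugate (N $$ (j, s))) * c' j) =
    (\<Sum>r<q. \<Sum>s<q. conjugate (adjoint_apply n M c r) * V $$ (r, s) * adjoint_apply n N c' s)"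
    (is "?l = ?r") for M N :: "'a mat"
  proof -
    have "?l = (\<Sum>r<q. \<Sum>s<q. \<Sum>i<n. \<Sum>j<n.
      conjugate (c i) * (M $$ (i, r) * V $$ (r, s) * conjugate (N $$ (j, s))) * c' j)"
      unfolding sum_distrib_left sum_distrib_right by (rule sum_swap_pairs)
    also have "\<dots> = ?r"
      by (intro sum.cong refl)
        (simp add: adjoint_apply_def sum_conjugate conjugate_dist_mul sum_distrib_left
          sum_distrib_right mult_ac)
    finally show ?thesis .
  qed
  have pull_in: "a * (\<Sum>k<m. \<Sum>l<m. h k l * e k l) * b = (\<Sum>k<m. \<Sum>l<m. h k l * (a * e k l * b))"
    for a b :: 'a and h e
    by (simp add: sum_distrib_left sum_distrib_right mult_ac)
  have "(\<Sum>i<n. \<Sum>j<n. conjugate (c i) * L V $$ (i, j) * c' j) =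
    (\<Sum>i<n. \<Sum>j<n. \<Sum>k<m. \<Sum>l<m. H $$ (k, l) * (conjugate (c i) *
      (\<Sum>r<q. \<Sum>s<q. A k $$ (i, r) * V $$ (r, s) * conjugate (A l $$ (j, s))) * c' j))"
  proof (intro sum.cong refl)
    fix i j assume ij: "i \<in> {..<n}" "j \<in> {..<n}"
    have "L V $$ (i, j) = (\<Sum>k<m. \<Sum>l<m. H $$ (k, l) * (A k * V * mat_adjoint (A l)) $$ (i, j))"
      using hill V ij unfolding hill_rep_def by (metis (no_types, lifting) index_mat(1) lessThan_iff split_conv)
    also have "\<dots> = (\<Sum>k<m. \<Sum>l<m. H $$ (k, l) *
        (\<Sum>r<q. \<Sum>s<q. A k $$ (i, r) * V $$ (r, s) * conjugate (A l $$ (j, s))))"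
      using hill V ij
      by (intro sum.cong refl arg_cong2[where f = "(*)"] index_mult_mult_adjoint)
        (auto simp: hill_rep_def)
    finally show "conjugate (c i) * L V $$ (i, j) * c' j = (\<Sum>k<m. \<Sum>l<m. H $$ (k, l) * (conjugate (c i) *
      (\<Sum>r<q. \<Sum>s<q. A k $$ (i, r) * V $$ (r, s) * conjugate (A l $$ (j, s))) * c' j))"
      by (simp only: pull_in)
  qed
  also have "\<dots> = (\<Sum>k<m. \<Sum>l<m. H $$ (k, l) * (\<Sum>i<n. \<Sum>j<n. conjugate (c i) *
      (\<Sum>r<q. \<Sum>s<q. A k $$ (i, r) * V $$ (r, s) * conjugate (A l $$ (j, s))) * c' j))"
    by (subst sum_swap_pairs) (simp only: sum_distrib_left[of "H $$ _"])
  finally show ?thesis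
    unfolding one .
qed

lemma A_hat_kronecker_index:
  assumes A: "\<forall>k < m. A k \<in> carrier_mat n q" and x: "x \<in> carrier_vec n" and z: "z \<in> carrier_vec q"
    and k: "k < m"
  shows "(A_hat q n m A *\<^sub>v kronecker_vec z x) $ k =
    (\<Sum>s<q. adjoint_apply n (A k) (($) x) s * z $ s)"
proof -
  have "(A_hat q n m A *\<^sub>v kronecker_vec z x) $ k =
    (\<Sum>p<q * n. conjugate (A k $$ (p mod n, p div n)) * (z $ (p div n) * x $ (p mod n)))"
    using A[rule_format, OF k] x z k
    by (auto simp: A_hat_def mat_adjoint_index kronecker_vec_def mat_of_cols_def vectorize_def
        scalar_prod_def atLeast0LessThan mult.commute[of n q] intro!: sum.cong)
  also have "\<dots> = (\<Sum>s<q. \<Sum>j<n. conjugate (A k $$ (j, s)) * (z $ s * x $ j))"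
    unfolding sum_blocks by (intro sum.cong refl) auto
  finally show ?thesis
    unfolding adjoint_apply_def sum_distrib_right by (simp add: mult_ac)
qed

lemma psd_rank_one:
  fixes z :: "nat \<Rightarrow> 'a :: conjugatable_ordered_field"
  shows "psd q (mat q q (\<lambda>(r, s). conjugate (z r) * z s))"
proof -
  let ?P = "mat q q (\<lambda>(r, s). conjugate (z r) * z s)"
  have "quad_form {..<q} (\<lambda>r s. ?P $$ (r, s)) c =
      quad_form {..<q} (\<lambda>r s. 1 * (conjugate (z r) * z s)) c" for c
    unfolding quad_form_def by (intro sum.cong) auto
  then have "nonneg_kernel {..<q} (\<lambda>r s. ?P $$ (r, s))"
    unfolding nonneg_kernel_def quad_form_rank_one by (simp add: conjugate_square_positive)
  then show ?thesis
    by (simp add: psd_iff_kernel hermitian_kernel_def conjugate_dist_mul mult.commute)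
qed

text \<open>
  Positivity of \<open>L\<close> on rank-one matrices controls the form of \<open>H\<close> on the vectors
  \<open>A_hat (z \<otimes> x)\<close> only; by hypothesis these are all vectors.
\<close>
lemma hill_matrix_nonneg:
  fixes L :: "'a :: conjugatable_ordered_field mat \<Rightarrow> 'a mat"
  assumes hill: "hill_rep q n L m H A" and pos: "positive_map q n L"
    and Y: "Y_set q n (A_hat q n m A) = carrier_vec m"
  shows "nonneg_kernel {..<m} (\<lambda>k l. H $$ (k, l))"
  unfolding nonneg_kernel_def
proof
  fix y :: "nat \<Rightarrow> 'a"
  have "vec m y \<in> Y_set q n (A_hat q n m A)"
    unfolding Y by simp
  then obtain x z where x: "x \<in> carrier_vec n" and z: "z \<in> carrier_vec q"
    and yxz: "vec m y = A_hat q n m A *\<^sub>v kronecker_vec z x"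
    unfolding Y_set_def by blast
  define w where "w k = adjoint_apply n (A k) (($) x)" for k
  have y: "y k = (\<Sum>s<q. w k s * z $ s)" if "k < m" for k
  proof -
    have "y k = vec m y $ k"
      using that by simp
    then show ?thesis
      unfolding yxz w_def using hill x z that by (simp add: A_hat_kronecker_index hill_rep_def)
  qed
  (* The conjugate stands on the row index, so P is the rank-one matrix of the conjugate of z:
     the entries of A_hat are already conjugated. *)
  define P where "P = mat q q (\<lambda>(r, s). conjugate (z $ r) * z $ s)"
  have P: "P \<in> carrier_mat q q"
    by (simp add: P_def)
  have "psd n (L P)"
    using pos psd_rank_one[of q "($) z"] unfolding positive_map_def P_def by blast
  then have "0 \<le> (\<Sum>i<n. \<Sum>j<n. conjugate (x $ i) * L P $$ (i, j) * x $ j)"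
    unfolding psd_iff_kernel nonneg_kernel_def quad_form_def by blast
  also have "\<dots> = (\<Sum>k<m. \<Sum>l<m. H $$ (k, l) *
      (\<Sum>r<q. \<Sum>s<q. conjugate (w k r) * P $$ (r, s) * w l s))"
    unfolding w_def by (rule hill_rep_form[OF hill P])
  also have "\<dots> = (\<Sum>k<m. \<Sum>l<m. H $$ (k, l) * (conjugate (y k) * y l))"
  proof (intro sum.cong refl arg_cong2[where f = "(*)"])
    fix k l assume "k \<in> {..<m}" "l \<in> {..<m}"
    then have "conjugate (y k) * y l =
        (\<Sum>r<q. \<Sum>s<q. conjugate (w k r * z $ r) * (w l s * z $ s))"
      by (simp add: y sum_product sum_conjugate)
    then show "(\<Sum>r<q. \<Sum>s<q. conjugate (w k r) * P $$ (r, s) * w l s) = conjugate (y k) * y l"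
      by (simp add: P_def conjugate_dist_mul mult_ac)
  qed
  also have "\<dots> = quad_form {..<m} (\<lambda>k l. H $$ (k, l)) y"
    by (simp add: quad_form_def mult_ac)
  finally show "0 \<le> quad_form {..<m} (\<lambda>k l. H $$ (k, l)) y" .
qed

section \<open>Block matrices and complete positivity\<close>

lemma block_index_less:
  assumes "a < k" "i < (d :: nat)"
  shows "a * d + i < k * d"
proof -
  have "a * d + i < Suc a * d" using assms by simp
  also have "\<dots> \<le> k * d" using assms by (intro mult_le_mono1) simp
  finally show ?thesis .
qed

lemma block_mat_index:
  assumes "a < k" "b < k" "i < d" "j < d"
  shows "block_mat k d B $$ (a * d + i, b * d + j) = B a b $$ (i, j)"
  using assms by (simp add: block_mat_def block_index_less)

lemma block_mat_carrier [simp]: "block_mat k d B \<in> carrier_mat (k * d) (k * d)"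
  by (simp add: block_mat_def)

lemma sum_block_form:
  "(\<Sum>i<k * d. \<Sum>j<k * d. f i * block_mat k d B $$ (i, j) * g j) =
    (\<Sum>a<k. \<Sum>b<k. \<Sum>i<d. \<Sum>j<d. f (a * d + i) * B a b $$ (i, j) * g (b * d + j))"
proof -
  have "(\<Sum>i<k * d. \<Sum>j<k * d. f i * block_mat k d B $$ (i, j) * g j) =
    (\<Sum>a<k. \<Sum>i<d. \<Sum>b<k. \<Sum>j<d. f (a * d + i) * B a b $$ (i, j) * g (b * d + j))"
    unfolding sum_blocks by (intro sum.cong refl) (simp add: block_mat_index)
  also have "\<dots> = (\<Sum>a<k. \<Sum>b<k. \<Sum>i<d. \<Sum>j<d. f (a * d + i) * B a b $$ (i, j) * g (b * d + j))"
    by (intro sum.cong refl sum.swap)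
  finally show ?thesis .
qed

lemma hermitian_block_mat_iff:
  assumes "\<forall>a < k. \<forall>b < k. B a b \<in> carrier_mat d d"
  shows "hermitian_kernel {..<k * d} (\<lambda>i j. block_mat k d B $$ (i, j)) \<longleftrightarrow>
    (\<forall>a < k. \<forall>b < k. mat_adjoint (B a b) = B b a)" (is "?l \<longleftrightarrow> ?r")
proof
  assume l: ?l
  show ?r
  proof (intro allI impI)
    fix a b assume ab: "a < k" "b < k"
    have "conjugate (B a b $$ (j, i)) = B b a $$ (i, j)" if "i < d" "j < d" for i j
    proof -
      have "conjugate (block_mat k d B $$ (a * d + j, b * d + i)) =
          block_mat k d B $$ (b * d + i, a * d + j)"
        using l ab that by (simp add: hermitian_kernel_def block_index_less)
      then show ?thesis
        using ab that by (simp add: block_mat_index)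
    qed
    moreover have "dim_row (B a b) = d" "dim_col (B a b) = d" "dim_row (B b a) = d" "dim_col (B b a) = d"
      using assms ab by auto
    ultimately show "mat_adjoint (B a b) = B b a"
      by (auto simp: mat_adjoint_index mat_eq_iff)
  qed
next
  assume r: ?r
  show ?l
    unfolding hermitian_kernel_def
  proof (intro ballI)
    fix i j assume ij: "i \<in> {..<k * d}" "j \<in> {..<k * d}"
    then have d: "d > 0" by (cases d) auto
    from ij have div: "i div d < k" "j div d < k"
      by (auto simp: less_mult_imp_div_less)
    have "B (j div d) (i div d) = mat_adjoint (B (i div d) (j div d))"
      using r div by simp
    moreover have "dim_row (B (i div d) (j div d)) = d" "dim_col (B (i div d) (j div d)) = d"
      using assms div by auto
    ultimately show "conjugate (block_mat k d B $$ (i, j)) = block_mat k d B $$ (j, i)"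
      using ij d by (simp add: block_mat_def mat_adjoint_index)
  qed
qed

text \<open>
  The form of \<open>G\<close> at \<open>c\<close> is the form of \<open>M\<close> at the combination of the \<open>w k\<close> with coefficients \<open>c k\<close>.
\<close>
lemma gram_kernel:
  fixes M :: "'i \<Rightarrow> 'i \<Rightarrow> 'a :: conjugatable_ordered_field"
    and w :: "'k \<Rightarrow> 'i \<Rightarrow> 'a"
  assumes "finite I" "nonneg_kernel I M" "hermitian_kernel I M"
  defines "G \<equiv> \<lambda>k l. \<Sum>i\<in>I. \<Sum>j\<in>I. conjugate (w k i) * M i j * w l j"
  shows "nonneg_kernel S G" "hermitian_kernel S G"
proof -
  show "nonneg_kernel S G"
    unfolding nonneg_kernel_def
  proof
    fix c
    show "0 \<le> quad_form S G c"
    proof (cases "finite S")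
      case True
      have "quad_form S G c = (\<Sum>k\<in>S. \<Sum>l\<in>S. \<Sum>i\<in>I. \<Sum>j\<in>I.
          conjugate (c k) * (conjugate (w k i) * M i j * w l j) * c l)"
        by (simp only: quad_form_def G_def sum_distrib_left sum_distrib_right)
      also have "\<dots> = (\<Sum>i\<in>I. \<Sum>j\<in>I. \<Sum>k\<in>S. \<Sum>l\<in>S.
          conjugate (c k) * (conjugate (w k i) * M i j * w l j) * c l)"
        by (rule sum_swap_pairs)
      also have "\<dots> = quad_form I M (\<lambda>i. \<Sum>k\<in>S. c k * w k i)"
        unfolding quad_form_def
        by (intro sum.cong refl) (simp add: sum_conjugate[OF True] conjugate_dist_mul sum_distrib_left
          sum_distrib_right mult_ac)
      finally show ?thesis
        using assms(2) by (simp add: nonneg_kernel_def)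
    qed (simp add: quad_form_def)
  qed
  have "conjugate (G k l) = G l k" for k l
  proof -
    have "conjugate (G k l) = (\<Sum>i\<in>I. \<Sum>j\<in>I. w k i * M j i * conjugate (w l j))"
      unfolding G_def sum_conjugate[OF assms(1)] using assms(3)
      by (simp add: hermitian_kernel_def conjugate_dist_mul)
    also have "\<dots> = (\<Sum>j\<in>I. \<Sum>i\<in>I. w k i * M j i * conjugate (w l j))"
      by (rule sum.swap)
    finally show ?thesis
      by (simp add: G_def mult_ac)
  qed
  then show "hermitian_kernel S G"
    by (simp add: hermitian_kernel_def)
qed

text \<open>
  The form of the block matrix of the \<open>L (V a b)\<close> is the pairing of \<open>H\<close> with a Gram kernel of the
  block matrix of the \<open>V a b\<close>. Self-adjointness comes separately, from \<open>L\<close> commuting with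
  adjoints, since over the reals it does not follow from nonnegativity of the form.
\<close>
lemma completely_positive_if_hill_nonneg:
  fixes L :: "'a :: {conjugatable_ordered_field, ordered_comm_ring} mat \<Rightarrow> 'a mat"
  assumes star: "star_linear q n L" and hill: "hill_rep q n L m H A"
    and nonneg: "nonneg_kernel {..<m} (\<lambda>k l. H $$ (k, l))"
  shows "completely_positive q n L"
  unfolding completely_positive_def
proof (intro allI impI)
  fix N :: nat and V :: "nat \<Rightarrow> nat \<Rightarrow> 'a mat"
  assume V: "\<forall>a < N. \<forall>b < N. V a b \<in> carrier_mat q q" and psd: "psd (N * q) (block_mat N q V)"
  let ?V = "\<lambda>i j. block_mat N q V $$ (i, j)"
  let ?LV = "block_mat N n (\<lambda>a b. L (V a b))"
  from psd have V_herm: "hermitian_kernel {..<N * q} ?V" and V_nonneg: "nonneg_kernel {..<N * q} ?V"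
    by (simp_all add: psd_iff_kernel)
  have LV: "\<forall>a < N. \<forall>b < N. L (V a b) \<in> carrier_mat n n"
    using V hill by (simp add: hill_rep_def)
  have "mat_adjoint (V a b) = V b a" if "a < N" "b < N" for a b
    using V_herm that by (simp add: hermitian_block_mat_iff[OF V])
  then have "mat_adjoint (L (V a b)) = L (V b a)" if "a < N" "b < N" for a b
    using star V that by (metis star_linear_def)
  then have herm: "hermitian_kernel {..<N * n} (\<lambda>i j. ?LV $$ (i, j))"
    by (simp add: hermitian_block_mat_iff[OF LV])
  have "nonneg_kernel {..<N * n} (\<lambda>i j. ?LV $$ (i, j))"
    unfolding nonneg_kernel_def
  proof
    fix c
    (* Position p lies in block p div q, at offset p mod q; the blocks of w k have length q,
       those of c have length n. *)
    define w where "w k p = adjoint_apply n (A k) (\<lambda>j. c (p div q * n + j)) (p mod q)" for k p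
    define G where "G k l = (\<Sum>i<N * q. \<Sum>j<N * q. conjugate (w k i) * ?V i j * w l j)" for k l
    have w: "w k (a * q + r) = adjoint_apply n (A k) (\<lambda>j. c (a * n + j)) r" if "r < q" for k a r
      using that by (simp add: w_def)
    have G: "G k l = (\<Sum>a<N. \<Sum>b<N. \<Sum>r<q. \<Sum>s<q.
        conjugate (adjoint_apply n (A k) (\<lambda>j. c (a * n + j)) r) * V a b $$ (r, s) *
        adjoint_apply n (A l) (\<lambda>j. c (b * n + j)) s)" for k l
      unfolding G_def sum_block_form by (intro sum.cong refl) (simp add: w)
    have "quad_form {..<N * n} (\<lambda>i j. ?LV $$ (i, j)) c =
      (\<Sum>a<N. \<Sum>b<N. \<Sum>i<n. \<Sum>j<n. conjugate (c (a * n + i)) * L (V a b) $$ (i, j) * c (b * n + j))"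
      unfolding quad_form_def by (rule sum_block_form)
    also have "\<dots> = (\<Sum>a<N. \<Sum>b<N. \<Sum>k<m. \<Sum>l<m. H $$ (k, l) * (\<Sum>r<q. \<Sum>s<q.
        conjugate (adjoint_apply n (A k) (\<lambda>j. c (a * n + j)) r) * V a b $$ (r, s) *
        adjoint_apply n (A l) (\<lambda>j. c (b * n + j)) s))"
      using V by (intro sum.cong refl hill_rep_form[OF hill]) auto
    also have "\<dots> = (\<Sum>k<m. \<Sum>l<m. H $$ (k, l) * G k l)"
      unfolding G by (subst sum_swap_pairs) (simp only: sum_distrib_left[of "H $$ _"])
    also have "0 \<le> \<dots>"
      using gram_kernel[OF _ V_nonneg V_herm, of "{..<m}" w] nonneg
      by (intro nonneg_kernel_pairing) (simp_all add: G_def)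
    finally show "0 \<le> quad_form {..<N * n} (\<lambda>i j. ?LV $$ (i, j)) c" .
  qed
  with herm show "psd (N * n) ?LV"
    by (simp add: psd_iff_kernel)
qed

theorem corollary3p2:
  fixes q n :: nat
  shows
    "(\<forall>(L :: complex mat \<Rightarrow> complex mat) m H A.
        star_linear q n L \<longrightarrow> positive_map q n L \<longrightarrow>
        m = vec_space.rank (n * q) (choi_matrix q n L) \<longrightarrow>
        minimal_hill_rep q n L m H A \<longrightarrow>
        Y_set q n (A_hat q n m A) = carrier_vec m \<longrightarrow>
        completely_positive q n L) \<and>
     (\<forall>(L :: real mat \<Rightarrow> real mat) m H A.
        star_linear q n L \<longrightarrow> positive_map q n L \<longrightarrow>
        m = vec_space.rank (n * q) (choi_matrix q n L) \<longrightarrow>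
        minimal_hill_rep q n L m H A \<longrightarrow>
        Y_set q n (A_hat q n m A) = carrier_vec m \<longrightarrow>
        completely_positive q n L)"
proof (intro conjI allI impI)
  fix L :: "complex mat \<Rightarrow> complex mat" and m H A
  assume "star_linear q n L" "positive_map q n L" "minimal_hill_rep q n L m H A"
    "Y_set q n (A_hat q n m A) = carrier_vec m"
  then show "completely_positive q n L"
    by (intro completely_positive_if_hill_nonneg[of _ _ _ m H A] hill_matrix_nonneg[of q n L m H A])
      (simp_all add: minimal_hill_rep_def)
next
  fix L :: "real mat \<Rightarrow> real mat" and m H A
  assume "star_linear q n L" "positive_map q n L" "minimal_hill_rep q n L m H A"
    "Y_set q n (A_hat q n m A) = carrier_vec m"
  then show "completely_positive q n L"
    by (intro completely_positive_if_hill_nonneg[of _ _ _ m H A] hill_matrix_nonneg[of q n L m H A])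
      (simp_all add: minimal_hill_rep_def)
qed

end
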